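(* Let $m \ge 1$ and $c \ge 0$ be integers, and let $b \ge 2m$ be an integer. Then Breaker wins the $c$-boosted $(m,b)$ Maker-Breaker percolation game on $\mathbb{Z}^2$, and moreover, he can ensure to win within the first $$(2c+4)(2c+5)\left(\left\lceil \frac{2c+2}{m}\right\rceil + 1\right)$$ rounds.
   Context: $\mathbb{Z}^2$ denotes the square lattice: the infinite graph whose vertices are the points $(x,y)$ with $x,y\in\mathbb{Z}$, two points being joined by an edge iff $|x-x'|+|y-y'|=1$. Fix an origin vertex $v_0$. The $(m,b)$ Maker-Breaker percolation game on $\mathbb{Z}^2$ is played on the edge set of $\mathbb{Z}^2$. In each round $1,2,3,\dots$, first Maker claims $m$ as yet unclaimed edges, then Breaker claims $b$ as yet unclaimed edges. Breaker wins if at some finite point of the game he has claimed at least one edge of every infinite connected subgraph of $\mathbb{Z}^2$ containing $v_0$; equivalently, if the connected component of $v_0$ in the graph formed by Maker's edges and the unclaimed edges becomes finite. Otherwise Maker wins. The $c$-boosted $(m,b)$ game is the same game, except that in her very first turn only, Maker claims $c$ extra edges (so $m+c$ edges in her first turn). *)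

theory Defs
  imports Complex_Main
begin

type_synonym vertex = "int \<times> int"
type_synonym edge = "vertex set"

definition lattice_edges :: "edge set" where
  "lattice_edges = {{(x, y), (x', y')} |x y x' y'. \<bar>x - x'\<bar> + \<bar>y - y'\<bar> = 1}"

definition lattice_subgraph :: "vertex set \<Rightarrow> edge set \<Rightarrow> bool" where
  "lattice_subgraph V E \<longleftrightarrow> E \<subseteq> lattice_edges \<and> \<Union>E \<subseteq> V"

definition joined :: "edge set \<Rightarrow> (vertex \<times> vertex) set" where
  "joined E = {(u, v). {u, v} \<in> E}\<^sup>*"

definition connected_graph :: "vertex set \<Rightarrow> edge set \<Rightarrow> bool" where
  "connected_graph V E \<longleftrightarrow> (\<forall>u\<in>V. \<forall>v\<in>V. (u, v) \<in> joined E)"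

text \<open>The winning condition for Breaker, where \<open>F\<close> is the set of edges he has claimed so far.
  It is preserved when \<open>F\<close> grows, so it does not matter that play formally continues
  after Breaker has won.\<close>

definition breaker_has_won :: "vertex \<Rightarrow> edge set \<Rightarrow> bool" where
  "breaker_has_won v0 F \<longleftrightarrow>
     (\<forall>V E. lattice_subgraph V E \<and> connected_graph V E \<and> infinite V \<and> v0 \<in> V \<longrightarrow> E \<inter> F \<noteq> {})"

text \<open>A play is a pair of sequences \<open>M\<close>, \<open>B\<close>: in round \<open>r\<close> (counted from 0) Maker claims the
  set \<open>M r\<close>, and then Breaker claims the set \<open>B r\<close>.\<close>

definition claimed_before :: "(nat \<Rightarrow> edge set) \<Rightarrow> (nat \<Rightarrow> edge set) \<Rightarrow> nat \<Rightarrow> edge set" where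
  "claimed_before M B r = (\<Union>i<r. M i \<union> B i)"

definition legal_maker_move ::
  "nat \<Rightarrow> nat \<Rightarrow> (nat \<Rightarrow> edge set) \<Rightarrow> (nat \<Rightarrow> edge set) \<Rightarrow> nat \<Rightarrow> bool" where
  "legal_maker_move m c M B r \<longleftrightarrow>
     M r \<subseteq> lattice_edges - claimed_before M B r \<and>
     finite (M r) \<and> card (M r) = (if r = 0 then m + c else m)"

definition legal_breaker_move ::
  "nat \<Rightarrow> (nat \<Rightarrow> edge set) \<Rightarrow> (nat \<Rightarrow> edge set) \<Rightarrow> nat \<Rightarrow> bool" where
  "legal_breaker_move b M B r \<longleftrightarrow>
     B r \<subseteq> lattice_edges - (claimed_before M B r \<union> M r) \<and>
     finite (B r) \<and> card (B r) = b"

text \<open>A strategy for Breaker maps the list of the moves made by Maker up to and including the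
  current round to Breaker's move in that round. Breaker's own earlier moves are determined by
  the strategy and Maker's moves, so they need not be arguments.\<close>

type_synonym strategy = "edge set list \<Rightarrow> edge set"

definition replies :: "strategy \<Rightarrow> (nat \<Rightarrow> edge set) \<Rightarrow> nat \<Rightarrow> edge set" where
  "replies \<sigma> M r = \<sigma> (map M [0..<Suc r])"

definition breaker_strategy :: "nat \<Rightarrow> nat \<Rightarrow> nat \<Rightarrow> strategy \<Rightarrow> bool" where
  "breaker_strategy m b c \<sigma> \<longleftrightarrow>
     (\<forall>M r. (\<forall>i\<le>r. legal_maker_move m c M (replies \<sigma> M) i) \<longrightarrow>
        legal_breaker_move b M (replies \<sigma> M) r)"

definition breaker_wins :: "nat \<Rightarrow> nat \<Rightarrow> nat \<Rightarrow> vertex \<Rightarrow> bool" where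
  "breaker_wins m b c v0 \<longleftrightarrow>
     (\<exists>\<sigma>. breaker_strategy m b c \<sigma> \<and>
        (\<forall>M. (\<forall>r. legal_maker_move m c M (replies \<sigma> M) r) \<longrightarrow>
           (\<exists>n. breaker_has_won v0 (\<Union>r<n. replies \<sigma> M r))))"

definition breaker_wins_within :: "nat \<Rightarrow> nat \<Rightarrow> nat \<Rightarrow> vertex \<Rightarrow> nat \<Rightarrow> bool" where
  "breaker_wins_within m b c v0 N \<longleftrightarrow>
     (\<exists>\<sigma>. breaker_strategy m b c \<sigma> \<and>
        (\<forall>M. (\<forall>r. legal_maker_move m c M (replies \<sigma> M) r) \<longrightarrow>
           (\<exists>n\<le>N. breaker_has_won v0 (\<Union>r<n. replies \<sigma> M r))))"

lemma breaker_has_won_mono: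
  "breaker_has_won v0 F \<Longrightarrow> F \<subseteq> F' \<Longrightarrow> breaker_has_won v0 F'"
  unfolding breaker_has_won_def by blast

text \<open>Equivalently, the component of \<open>v0\<close> in the graph of the edges not claimed by Breaker
  is finite.\<close>

lemma breaker_has_won_iff_finite_component:
  "breaker_has_won v0 F \<longleftrightarrow> finite {v. (v0, v) \<in> joined (lattice_edges - F)}"
proof
  let ?C = "{v. (v0, v) \<in> joined (lattice_edges - F)}"
  assume won: "breaker_has_won v0 F"
  show "finite ?C"
  proof (rule ccontr)
    assume inf: "infinite ?C"
    define E where "E = {e \<in> lattice_edges - F. e \<subseteq> ?C}"
    have v0: "v0 \<in> ?C" by (simp add: joined_def)
    have sub: "lattice_subgraph ?C E" by (auto simp: lattice_subgraph_def E_def)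
    have reach: "(v0, v) \<in> joined E" if "(v0, v) \<in> joined (lattice_edges - F)" for v
      using that unfolding joined_def
    proof (induction rule: rtrancl_induct)
      case base
      show ?case by simp
    next
      case (step y z)
      have "(v0, z) \<in> {(u, v). {u, v} \<in> lattice_edges - F}\<^sup>*"
        using step.hyps by (rule rtrancl_into_rtrancl)
      then have "{y, z} \<in> E"
        using step.hyps by (simp add: E_def joined_def)
      then show ?case using step.IH by (auto intro: rtrancl_into_rtrancl)
    qed
    have "sym {(u, v). {u, v} \<in> E}" by (auto simp: sym_def insert_commute)
    then have sym: "sym (joined E)" unfolding joined_def by (rule sym_rtrancl)
    have "connected_graph ?C E"
      unfolding connected_graph_def
    proof (intro ballI)
      fix u v assume "u \<in> ?C" "v \<in> ?C"
      then have "(u, v0) \<in> joined E" "(v0, v) \<in> joined E"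
        using reach[of u] reach[of v] symD[OF sym, of v0 u] by simp_all
      then show "(u, v) \<in> joined E" unfolding joined_def by (rule rtrancl_trans)
    qed
    then have "E \<inter> F \<noteq> {}"
      using won sub inf v0 unfolding breaker_has_won_def by blast
    then show False by (auto simp: E_def)
  qed
next
  assume fin: "finite {v. (v0, v) \<in> joined (lattice_edges - F)}"
  show "breaker_has_won v0 F"
    unfolding breaker_has_won_def
  proof (intro allI impI notI, elim conjE)
    fix V E
    assume sub: "lattice_subgraph V E" and con: "connected_graph V E"
      and inf: "infinite V" and v0: "v0 \<in> V" and disj: "E \<inter> F = {}"
    have "{(u, v). {u, v} \<in> E} \<subseteq> {(u, v). {u, v} \<in> lattice_edges - F}"
      using sub disj by (auto simp: lattice_subgraph_def)
    then have "joined E \<subseteq> joined (lattice_edges - F)"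
      unfolding joined_def by (rule rtrancl_mono)
    then have "V \<subseteq> {v. (v0, v) \<in> joined (lattice_edges - F)}"
      using con v0 by (auto simp: connected_graph_def)
    then show False using fin inf finite_subset by blast
  qed
qed

end

theory Submission
  imports Defs
begin

text \<open>Let \<open>C\<close> be the component of \<open>v0\<close> in Maker's graph. A \<^emph>\<open>head\<close> is an oriented lattice edge
  \<open>(y, z)\<close> that leaves \<open>C\<close> at \<open>y\<close> and is not claimed by Breaker; Breaker has won once there are no
  heads. Call a Maker edge outside \<open>C\<close> \<^emph>\<open>stray\<close>, and let the \<^emph>\<open>budget\<close> be the number of heads plus
  twice the number of stray edges. Every Maker edge raises the budget by at most 2: all vertices of
  the lattice have degree 4, and absorbing \<open>n\<close> new vertices into \<open>C\<close> uses up at least \<open>n\<close> Maker edges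
  (\<open>maker_turn.budget_increase\<close>). Each head claimed by Breaker lowers it by 1. The empty position
  has budget 4, so a Breaker who claims \<open>2 * m\<close> heads per round holds the budget at most
  \<open>2 * c + 4\<close> from the first round on, and it never rises again.

  It remains to force the budget down. A round that keeps the budget unchanged is \<^emph>\<open>tight\<close>, and in
  a tight round all estimates above are equalities: contracting \<open>C\<close> to a point, the absorbed part is
  a tree, and all other edges at absorbed vertices become heads. Hence Maker can never claim a
  \<^emph>\<open>doomed\<close> head \<open>(y, z)\<close>, one for which \<open>z\<close> has a second neighbour in \<open>C\<close>. If a head \<open>(y, z)\<close> is
  \<^emph>\<open>cornered\<close>, that is, \<open>z\<close> can be reached from \<open>C\<close> by a path of length two that avoids \<open>y\<close>, then
  claiming it leaves a new doomed head at \<open>z\<close>. Heads that are neither are \<^emph>\<open>loose\<close>, and each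
  absorbed vertex \<open>y\<close> has at most one of them, opposite to an edge by which \<open>y\<close> is attached.

  So Breaker claims loose heads first, then cornered ones, and doomed ones only when nothing else
  remains. As long as some loose head survives, the number of loose heads plus stray edges drops by
  at least \<open>m\<close> per tight round (\<open>tight_round.loose_decreasing\<close>). When no loose head is left, Maker
  must either claim a cornered head, and the number of doomed heads grows, never to shrink before
  all heads are doomed (\<open>tight_round.doomed_increasing\<close>), or place only stray edges, of which a
  budget \<open>u\<close> allows fewer than \<open>u / 2\<close>. A potential that combines the budget, the number of doomed heads and these two
  counters lexicographically therefore decreases in every round, and its initial value gives the
  bound on the number of rounds.\<close>

section \<open>Edges and components of the square lattice\<close>

lemma lattice_edge_iff:
  "{(a, b), (a', b')} \<in> lattice_edges \<longleftrightarrow> \<bar>a - a'\<bar> + \<bar>b - b'\<bar> = 1"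
  unfolding lattice_edges_def by (auto simp: doubleton_eq_iff)

lemma lattice_edgeE:
  assumes "e \<in> lattice_edges"
  obtains u v where "e = {u, v}" "u \<noteq> v"
proof -
  obtain x y x' y' where "e = {(x, y), (x', y')}" "\<bar>x - x'\<bar> + \<bar>y - y'\<bar> = 1"
    using assms unfolding lattice_edges_def by blast
  then show thesis by (intro that[of "(x, y)" "(x', y')"]) auto
qed

lemma lattice_edge_neq: "{u, v} \<in> lattice_edges \<Longrightarrow> u \<noteq> v"
  by (cases u; cases v) (auto simp: lattice_edge_iff)

lemma lattice_neighbours:
  "{z. {(a, b), z} \<in> lattice_edges} = {(a + 1, b), (a - 1, b), (a, b + 1), (a, b - 1)}"
proof -
  have "\<bar>a - x\<bar> + \<bar>b - y\<bar> = 1 \<longleftrightarrow>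
      (x = a + 1 \<and> y = b) \<or> (x = a - 1 \<and> y = b) \<or> (x = a \<and> y = b + 1) \<or> (x = a \<and> y = b - 1)"
    for x y by smt
  then show ?thesis by (simp add: set_eq_iff split_paired_all lattice_edge_iff)
qed

lemma card_lattice_neighbours: "card {z. {y, z} \<in> lattice_edges} = 4"
  by (cases y) (simp add: lattice_neighbours)

lemma infinite_lattice_edges: "infinite lattice_edges"
proof -
  define f where "f n = {(int n, 0 :: int), (int n + 1, 0)}" for n
  have "inj f" by (auto simp: inj_def f_def doubleton_eq_iff)
  moreover have "range f \<subseteq> lattice_edges" by (auto simp: f_def lattice_edge_iff)
  ultimately show ?thesis using finite_subset finite_imageD infinite_UNIV_nat by metis
qed

text \<open>Of three distinct neighbours of \<open>y\<close>, at most one of \<open>z\<close>, \<open>z'\<close> is opposite to \<open>p\<close>; the other one is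
  perpendicular to it, and \<open>w\<close> completes the unit square spanned by the two.\<close>
lemma two_neighbours_corner:
  assumes "{y, p} \<in> lattice_edges" "{y, z} \<in> lattice_edges" "{y, z'} \<in> lattice_edges"
    and "p \<noteq> z" "p \<noteq> z'" "z \<noteq> z'"
  shows "\<exists>w. w \<noteq> y \<and> {p, w} \<in> lattice_edges \<and> ({w, z} \<in> lattice_edges \<or> {w, z'} \<in> lattice_edges)"
proof -
  obtain a b where y: "y = (a, b)" by (cases y)
  let ?n = "{(a + 1, b), (a - 1, b), (a, b + 1), (a, b - 1)}"
  have "p \<in> ?n" "z \<in> ?n" "z' \<in> ?n"
    using assms(1-3) lattice_neighbours[of a b] unfolding y by blast+
  moreover have "\<exists>w. w \<noteq> y \<and> {p, w} \<in> lattice_edges \<and> {w, z} \<in> lattice_edges"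
    if "fst p \<noteq> fst z" "snd p \<noteq> snd z" "p \<in> ?n" "z \<in> ?n" for p z
    using that unfolding y
    by (intro exI[of _ "(fst p + fst z - a, snd p + snd z - b)"]) (auto simp: lattice_edge_iff)
  moreover have "fst p \<noteq> fst z \<and> snd p \<noteq> snd z \<or> fst p \<noteq> fst z' \<and> snd p \<noteq> snd z'"
    using calculation(1-3) assms(4-6) by (elim insertE emptyE) simp_all
  ultimately show ?thesis by meson
qed

definition component :: "vertex \<Rightarrow> edge set \<Rightarrow> vertex set" where
  "component v0 A = {v. (v0, v) \<in> joined A}"

lemma root_in_component: "v0 \<in> component v0 A"
  by (simp add: component_def joined_def)

lemma component_step:
  "y \<in> component v0 A \<Longrightarrow> {y, z} \<in> A \<Longrightarrow> z \<in> component v0 A"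
  unfolding component_def joined_def by (auto intro: rtrancl_into_rtrancl)

lemma component_mono: "A \<subseteq> A' \<Longrightarrow> component v0 A \<subseteq> component v0 A'"
  unfolding component_def joined_def
  using rtrancl_mono[of "{(u, v). {u, v} \<in> A}" "{(u, v). {u, v} \<in> A'}"] by blast

lemma component_closed:
  assumes "v0 \<in> S" and closed: "\<And>s t. s \<in> S \<Longrightarrow> {s, t} \<in> A \<Longrightarrow> t \<in> S"
  shows "component v0 A \<subseteq> S"
proof
  fix v assume "v \<in> component v0 A"
  then have "(v0, v) \<in> {(u, v). {u, v} \<in> A}\<^sup>*" by (simp add: component_def joined_def)
  then show "v \<in> S" by (induction rule: rtrancl_induct) (use assms in auto)
qed

lemma finite_component:
  assumes "finite A" "A \<subseteq> lattice_edges"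
  shows "finite (component v0 A)"
proof -
  have "component v0 A \<subseteq> insert v0 (\<Union>A)" by (rule component_closed) auto
  moreover have "finite (\<Union>A)" using assms by (auto elim!: lattice_edgeE)
  ultimately show ?thesis by (meson finite_insert finite_subset)
qed

lemma component_cut:
  assumes "S \<subseteq> component v0 A" "S \<noteq> {}" "v0 \<notin> S"
  shows "\<exists>s\<in>S. \<exists>t\<in>component v0 A - S. {s, t} \<in> A"
proof (rule ccontr)
  assume no: "\<not> ?thesis"
  have "component v0 A \<subseteq> component v0 A - S"
  proof (rule component_closed)
    fix s t assume "s \<in> component v0 A - S" "{s, t} \<in> A"
    then show "t \<in> component v0 A - S"
      using no component_step[of s v0 A t] by (metis Diff_iff insert_commute)
  qed (use assms root_in_component in auto)
  then show False using assms by blast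
qed

section \<open>Counting the edges of a growing component\<close>

lemma absorb_vertex:
  fixes E :: "'a set set"
  assumes "finite E" "v \<in> N"
  shows "card {e \<in> E. e \<inter> N \<noteq> {}} =
    card {e \<in> E. e \<inter> (N - {v}) \<noteq> {}} + card {e \<in> E. v \<in> e \<and> e \<inter> (N - {v}) = {}}"
proof -
  have "{e \<in> E. e \<inter> N \<noteq> {}} =
      {e \<in> E. e \<inter> (N - {v}) \<noteq> {}} \<union> {e \<in> E. v \<in> e \<and> e \<inter> (N - {v}) = {}}"
    using assms by auto
  then show ?thesis using assms by (simp add: card_Un_disjoint disjoint_iff)
qed

text \<open>Every vertex of \<open>N\<close> is joined to \<open>C\<close> by a path in \<open>C \<union> N\<close>, expressed by cuts: this form
  is inherited without change when a vertex is moved from \<open>N\<close> to \<open>C\<close>.\<close>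
definition attached :: "'a set set \<Rightarrow> 'a set \<Rightarrow> 'a set \<Rightarrow> bool" where
  "attached E C N \<longleftrightarrow> C \<inter> N = {} \<and>
     (\<forall>S\<subseteq>N. S \<noteq> {} \<longrightarrow> (\<exists>s\<in>S. \<exists>t\<in>(C \<union> N) - S. {s, t} \<in> E))"

lemma attached_absorb:
  assumes "attached E C N" "v \<in> N" shows "attached E (insert v C) (N - {v})"
proof -
  have un: "insert v C \<union> (N - {v}) = C \<union> N" using assms by auto
  show ?thesis
    unfolding attached_def un
  proof (intro conjI allI impI)
    show "insert v C \<inter> (N - {v}) = {}" using assms by (auto simp: attached_def)
    fix S assume "S \<subseteq> N - {v}" "S \<noteq> {}"
    then show "\<exists>s\<in>S. \<exists>t\<in>C \<union> N - S. {s, t} \<in> E"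
      using assms unfolding attached_def by (meson Diff_subset order_trans)
  qed
qed

lemma attached_disjoint: "attached E C N \<Longrightarrow> C \<inter> N = {}"
  by (simp add: attached_def)

lemma attached_edge:
  assumes "attached E C N" "N \<noteq> {}"
  obtains s t where "s \<in> N" "t \<in> C" "{s, t} \<in> E"
proof -
  have "\<exists>s\<in>N. \<exists>t\<in>(C \<union> N) - N. {s, t} \<in> E"
    using assms unfolding attached_def by (metis order_refl)
  then show thesis using that by blast
qed

lemma card_pos_if_mem: "finite E \<Longrightarrow> e \<in> E \<Longrightarrow> P e \<Longrightarrow> 0 < card {e \<in> E. P e}"
  by (auto simp: card_gt_0_iff)

text \<open>Absorb the vertices of \<open>N\<close> into \<open>C\<close> one at a time, each along an edge of \<open>E\<close> that leads into
  what has been absorbed already.\<close>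
lemma attached_card_le:
  assumes "finite N" "finite E" "attached E C N"
  shows "card N \<le> card {e \<in> E. e \<inter> N \<noteq> {}}"
  using assms(1,3)
proof (induction "card N" arbitrary: C N)
  case 0
  then show ?case by simp
next
  case (Suc n)
  from Suc.hyps have "N \<noteq> {}" by auto
  then obtain v t where vt: "v \<in> N" "t \<in> C" "{v, t} \<in> E"
    using attached_edge[OF Suc.prems(2)] by metis
  have n: "n = card (N - {v})" using Suc.hyps(2) Suc.prems(1) vt(1) by simp
  have "n \<le> card {e \<in> E. e \<inter> (N - {v}) \<noteq> {}}"
    using Suc.hyps(1)[OF n _ attached_absorb[OF Suc.prems(2) vt(1)]] Suc.prems(1) n by simp
  moreover have "0 < card {e \<in> E. v \<in> e \<and> e \<inter> (N - {v}) = {}}"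
    using vt attached_disjoint[OF Suc.prems(2)] by (intro card_pos_if_mem[OF assms(2) vt(3)]) auto
  ultimately show ?case using absorb_vertex[OF assms(2) vt(1)] Suc.hyps(2) by linarith
qed

text \<open>Absorbing \<open>z\<close> first uses up two edges at once. This and the next lemma are the two shortest ways
  in which \<open>N\<close> can fail to be attached to \<open>C\<close> like a tree.\<close>
lemma attached_two_edges_card_less:
  assumes "finite N" "finite E" "attached E C N"
    and z: "z \<in> N" "y \<in> C" "y' \<in> C" "y \<noteq> y'" "{z, y} \<in> E" "{z, y'} \<in> E"
  shows "card N < card {e \<in> E. e \<inter> N \<noteq> {}}"
proof -
  have "y \<notin> N" "y' \<notin> N" using attached_disjoint[OF assms(3)] z by auto
  then have "{{z, y}, {z, y'}} \<subseteq> {e \<in> E. z \<in> e \<and> e \<inter> (N - {z}) = {}}"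
    using z by simp
  then have "card {{z, y}, {z, y'}} \<le> card {e \<in> E. z \<in> e \<and> e \<inter> (N - {z}) = {}}"
    using assms(2) by (intro card_mono) auto
  moreover have "card {{z, y}, {z, y'}} = 2" using z by (simp add: doubleton_eq_iff)
  moreover have "card (N - {z}) \<le> card {e \<in> E. e \<inter> (N - {z}) \<noteq> {}}"
    using attached_card_le[OF _ assms(2) attached_absorb[OF assms(3) z(1)]] assms(1) by simp
  moreover have "card N = Suc (card (N - {z}))" using assms(1) z(1) by (rule card.remove)
  ultimately show ?thesis using absorb_vertex[OF assms(2) z(1)] by linarith
qed

text \<open>Once \<open>z\<close> is absorbed, \<open>w\<close> has two edges into the absorbed part.\<close>
lemma attached_cycle_card_less:
  assumes "finite N" "finite E" "attached E C N"
    and z: "z \<in> N" "w \<in> N" "z \<noteq> w" "y \<in> C" "x \<in> C"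
    and E: "{z, y} \<in> E" "{w, z} \<in> E" "{w, x} \<in> E"
  shows "card N < card {e \<in> E. e \<inter> N \<noteq> {}}"
proof -
  have "y \<notin> N" "x \<noteq> z" using attached_disjoint[OF assms(3)] z by auto
  then have "0 < card {e \<in> E. z \<in> e \<and> e \<inter> (N - {z}) = {}}"
    by (intro card_pos_if_mem[OF assms(2) E(1)]) auto
  moreover have "card (N - {z}) < card {e \<in> E. e \<inter> (N - {z}) \<noteq> {}}"
    by (rule attached_two_edges_card_less[OF _ assms(2) attached_absorb[OF assms(3) z(1)], of w z x])
      (use assms(1) z E \<open>x \<noteq> z\<close> in simp_all)
  moreover have "card N = Suc (card (N - {z}))" using assms(1) z(1) by (rule card.remove)
  ultimately show ?thesis using absorb_vertex[OF assms(2) z(1)] by linarith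
qed

section \<open>Heads and the budget of Maker\<close>

definition heads :: "vertex \<Rightarrow> edge set \<Rightarrow> edge set \<Rightarrow> (vertex \<times> vertex) set" where
  "heads v0 A B = {(y, z). y \<in> component v0 A \<and> z \<notin> component v0 A \<and> {y, z} \<in> lattice_edges - B}"

definition stray :: "vertex \<Rightarrow> edge set \<Rightarrow> edge set" where
  "stray v0 A = {e \<in> A. \<not> e \<subseteq> component v0 A}"

definition budget :: "vertex \<Rightarrow> edge set \<Rightarrow> edge set \<Rightarrow> nat" where
  "budget v0 A B = card (heads v0 A B) + 2 * card (stray v0 A)"

text \<open>Without heads, no edge outside \<open>B\<close> leaves Maker's component, which is finite.\<close>
lemma no_heads_breaker_has_won:
  assumes "finite A" "A \<subseteq> lattice_edges" "heads v0 A B = {}"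
  shows "breaker_has_won v0 B"
proof -
  have "component v0 (lattice_edges - B) \<subseteq> component v0 A"
    using assms(3) root_in_component unfolding heads_def by (intro component_closed) auto
  then show ?thesis
    using finite_component[OF assms(1,2)] finite_subset
    unfolding breaker_has_won_iff_finite_component component_def by blast
qed

lemma darts_Sigma: "{(y, z). y \<in> S \<and> {y, z} \<in> lattice_edges} = (SIGMA y:S. {z. {y, z} \<in> lattice_edges})"
  by auto

lemma finite_neighbours: "finite {z. {y, z} \<in> lattice_edges}"
  using card_lattice_neighbours[of y] card.infinite by fastforce

lemma finite_darts: "finite S \<Longrightarrow> finite {(y, z). y \<in> S \<and> {y, z} \<in> lattice_edges}"
  unfolding darts_Sigma using finite_neighbours by auto

lemma card_darts: "finite S \<Longrightarrow> card {(y, z). y \<in> S \<and> {y, z} \<in> lattice_edges} = 4 * card S"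
  unfolding darts_Sigma using finite_neighbours by (simp add: card_SigmaI card_lattice_neighbours)

lemma finite_heads:
  assumes "finite A" "A \<subseteq> lattice_edges" shows "finite (heads v0 A B)"
  by (rule finite_subset[OF _ finite_darts[OF finite_component[OF assms, of v0]]])
    (auto simp: heads_def)

lemma card_orientations:
  assumes "finite E" "E \<subseteq> lattice_edges"
  shows "card {(y, z). {y, z} \<in> E} = 2 * card E"
proof -
  have *: "{(y, z). {y, z} \<in> E} = (\<Union>e\<in>E. {(y, z). {y, z} = e})" by auto
  have two: "finite {(y, z). {y, z} = e} \<and> card {(y, z). {y, z} = e} = 2" if e: "e \<in> E" for e
  proof -
    obtain u v where uv: "e = {u, v}" "u \<noteq> v" using assms(2) e lattice_edgeE by blast
    then have "{(y, z). {y, z} = e} = {(u, v), (v, u)}" by (auto simp: doubleton_eq_iff)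
    then show ?thesis using uv by simp
  qed
  have "card (\<Union>e\<in>E. {(y, z). {y, z} = e}) = (\<Sum>e\<in>E. card {(y, z). {y, z} = e})"
    using assms(1) two by (intro card_UN_disjoint) auto
  also have "\<dots> = 2 * card E" using two by simp
  finally show ?thesis unfolding * .
qed

section \<open>Maker's turn\<close>

locale maker_turn =
  fixes v0 :: vertex and A B M :: "edge set"
  assumes fin: "finite A" "finite M"
    and lat: "A \<subseteq> lattice_edges" "M \<subseteq> lattice_edges"
    and free: "A \<inter> B = {}" "M \<inter> (A \<union> B) = {}"
begin

definition new :: "vertex set" where
  "new = component v0 (A \<union> M) - component v0 A"

definition new_edges :: "edge set" where
  "new_edges = {e \<in> A \<union> M. e \<inter> new \<noteq> {}}"

definition claimed_heads :: "(vertex \<times> vertex) set" where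
  "claimed_heads = {(y, z) \<in> heads v0 A B. {y, z} \<in> M}"

definition old_heads :: "(vertex \<times> vertex) set" where
  "old_heads = {(y, z) \<in> heads v0 (A \<union> M) B. y \<in> component v0 A}"

definition new_heads :: "(vertex \<times> vertex) set" where
  "new_heads = {(y, z) \<in> heads v0 (A \<union> M) B. y \<in> new}"

definition new_darts :: "(vertex \<times> vertex) set" where
  "new_darts = {(y, z). y \<in> new \<and> {y, z} \<in> A \<union> M}"

lemma comp_mono: "component v0 A \<subseteq> component v0 (A \<union> M)"
  by (rule component_mono) simp

lemma fin_new: "finite new"
  unfolding new_def using fin lat finite_component[of "A \<union> M" v0] by simp

lemma fin_heads: "finite (heads v0 A B)" "finite (heads v0 (A \<union> M) B)"
  using fin lat by (auto intro!: finite_heads)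

lemma heads_split: "heads v0 (A \<union> M) B = old_heads \<union> new_heads" "old_heads \<inter> new_heads = {}"
  unfolding old_heads_def new_heads_def new_def by (auto simp: heads_def)

lemma attached_new: "attached (A \<union> M) (component v0 A) new"
  unfolding attached_def
proof (intro conjI allI impI)
  show "component v0 A \<inter> new = {}" by (auto simp: new_def)
  have un: "component v0 A \<union> new = component v0 (A \<union> M)" using comp_mono by (auto simp: new_def)
  fix S assume "S \<subseteq> new" "S \<noteq> {}"
  then show "\<exists>s\<in>S. \<exists>t\<in>component v0 A \<union> new - S. {s, t} \<in> A \<union> M"
    unfolding un using root_in_component[of v0 A] by (intro component_cut) (auto simp: new_def)
qed

lemma new_edges_ge: "card new \<le> card new_edges"
  unfolding new_edges_def using fin by (intro attached_card_le[OF fin_new _ attached_new]) auto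

text \<open>An edge that attaches a new vertex to the old component cannot be an old Maker edge, so it was a
  head before this turn.\<close>
lemma old_to_new_edge:
  assumes "y \<in> component v0 A" "z \<in> new" "{y, z} \<in> A \<union> M"
  shows "(y, z) \<in> claimed_heads"
proof -
  have "z \<notin> component v0 A" using assms by (simp add: new_def)
  then have "{y, z} \<in> M" using assms component_step by blast
  then show ?thesis using assms lat free \<open>z \<notin> _\<close> by (auto simp: claimed_heads_def heads_def)
qed

lemma claimed_headsD:
  assumes "(y, z) \<in> claimed_heads"
  shows "y \<in> component v0 A" "z \<in> new" "{y, z} \<in> A \<union> M"
proof -
  show y: "y \<in> component v0 A" and e: "{y, z} \<in> A \<union> M"
    using assms by (auto simp: claimed_heads_def heads_def)
  show "z \<in> new" using assms component_step[of y v0 "A \<union> M" z, OF _ e] comp_mono y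
    by (auto simp: claimed_heads_def heads_def new_def)
qed

lemma no_claimed_heads: "claimed_heads = {} \<Longrightarrow> new = {}"
proof (rule ccontr)
  assume c: "claimed_heads = {}" and "new \<noteq> {}"
  then obtain s t where "s \<in> new" "t \<in> component v0 A" "{s, t} \<in> A \<union> M"
    using attached_edge[OF attached_new] by metis
  then show False using old_to_new_edge[of t s] c by (auto simp: insert_commute)
qed

text \<open>Each edge at a new vertex was stray or is freshly claimed, and it is not stray afterwards.\<close>
lemma stray_count: "card (stray v0 (A \<union> M)) + card new_edges \<le> card (stray v0 A) + card M"
proof -
  have "stray v0 (A \<union> M) \<inter> new_edges = {}"
  proof -
    have "e \<subseteq> component v0 (A \<union> M)" if "e \<in> new_edges" for e
    proof -
      have e: "e \<in> A \<union> M" "e \<inter> new \<noteq> {}" using that by (auto simp: new_edges_def)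
      then obtain u v where uv: "e = {u, v}" using lat lattice_edgeE by (metis Un_iff subsetD)
      then have "u \<in> component v0 (A \<union> M) \<longleftrightarrow> v \<in> component v0 (A \<union> M)"
        using e component_step[of u v0 "A \<union> M" v] component_step[of v v0 "A \<union> M" u]
        by (auto simp: insert_commute)
      then show ?thesis using e uv unfolding new_def by blast
    qed
    then show ?thesis by (auto simp: stray_def)
  qed
  then have "card (stray v0 (A \<union> M)) + card new_edges = card (stray v0 (A \<union> M) \<union> new_edges)"
    using fin by (subst card_Un_disjoint) (auto simp: stray_def new_edges_def)
  also have "\<dots> \<le> card (stray v0 A \<union> M)"
    using fin comp_mono by (intro card_mono) (auto simp: stray_def new_edges_def new_def)
  also have "\<dots> \<le> card (stray v0 A) + card M" by (rule card_Un_le)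
  finally show ?thesis .
qed

lemma old_heads_sub: "old_heads \<subseteq> heads v0 A B - claimed_heads"
proof -
  have "(y, z) \<notin> claimed_heads" if "(y, z) \<in> old_heads" for y z
    using that claimed_headsD(2)[of y z] by (auto simp: old_heads_def heads_def new_def)
  then show ?thesis using comp_mono by (auto simp: old_heads_def heads_def)
qed

lemma claimed_sub: "claimed_heads \<subseteq> heads v0 A B"
  by (auto simp: claimed_heads_def)

lemma old_heads_count: "card old_heads + card claimed_heads \<le> card (heads v0 A B)"
proof -
  have "card old_heads \<le> card (heads v0 A B - claimed_heads)"
    using old_heads_sub fin_heads by (intro card_mono) auto
  then show ?thesis using fin_heads claimed_sub
    by (metis (no_types, lifting) add.commute add_le_cancel_left card_Diff_subset card_mono
        finite_subset le_add_diff_inverse)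
qed

lemma new_darts_sub:
  "new_heads \<union> new_darts \<subseteq> {(y, z). y \<in> new \<and> {y, z} \<in> lattice_edges}"
  using lat by (auto simp: new_heads_def new_darts_def heads_def)

lemma new_darts_disj: "new_heads \<inter> new_darts = {}"
  using component_step[of _ v0 "A \<union> M"] by (auto simp: new_heads_def new_darts_def heads_def new_def)

lemma new_union_card: "card (new_heads \<union> new_darts) = card new_heads + card new_darts"
  using finite_subset[OF new_darts_sub finite_darts[OF fin_new]] new_darts_disj
  by (intro card_Un_disjoint) auto

lemma new_heads_count: "card new_heads + card new_darts \<le> 4 * card new"
  using card_mono[OF finite_darts[OF fin_new] new_darts_sub] card_darts[OF fin_new]
  by (simp add: new_union_card)

text \<open>Both sides count the orientations of Maker edges that touch a new vertex. Such an orientation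
  starts in a new vertex or enters one from the old component.\<close>
lemma new_darts_count: "card new_darts + card claimed_heads = 2 * card new_edges"
proof -
  have "{(y, z). {y, z} \<in> new_edges} = new_darts \<union> claimed_heads"
  proof -
    have "(y, z) \<in> new_darts \<union> claimed_heads" if e: "{y, z} \<in> new_edges" for y z
    proof (cases "y \<in> new")
      case True
      then show ?thesis using e by (simp add: new_darts_def new_edges_def)
    next
      case False
      then have z: "z \<in> new" "{y, z} \<in> A \<union> M" using e by (auto simp: new_edges_def)
      then have "y \<in> component v0 (A \<union> M)"
        using component_step[of z v0 "A \<union> M" y] by (auto simp: new_def insert_commute)
      then have "y \<in> component v0 A" using False by (simp add: new_def)
      then show ?thesis using z old_to_new_edge by simp
    qed
    moreover have "{y, z} \<in> new_edges" if "(y, z) \<in> new_darts \<union> claimed_heads" for y z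
      using that claimed_headsD[of y z] by (auto simp: new_darts_def new_edges_def)
    ultimately show ?thesis by auto
  qed
  moreover have "new_darts \<inter> claimed_heads = {}"
    using claimed_headsD(1) by (force simp: new_darts_def new_def)
  moreover have "finite new_darts" "finite claimed_heads"
    using finite_subset[OF new_darts_sub finite_darts[OF fin_new]]
      finite_subset[OF claimed_sub] fin_heads by auto
  moreover have "card {(y, z). {y, z} \<in> new_edges} = 2 * card new_edges"
    using fin lat by (intro card_orientations) (auto simp: new_edges_def)
  ultimately show ?thesis by (simp add: card_Un_disjoint)
qed

lemma card_heads_split: "card (heads v0 (A \<union> M) B) = card old_heads + card new_heads"
  using heads_split fin_heads(2) by (simp add: card_Un_disjoint)

text \<open>Let \<open>n\<close> be the number of new vertices and \<open>e\<close> the number of Maker edges touching them. The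
  previous counts add up to an increase of at most \<open>2 * card M + 4 * n - 4 * e\<close>, and \<open>n \<le> e\<close>.\<close>
lemma budget_increase: "budget v0 (A \<union> M) B \<le> budget v0 A B + 2 * card M"
  using stray_count old_heads_count new_heads_count new_darts_count new_edges_ge
  unfolding budget_def card_heads_split by linarith

end

text \<open>When the budget rises by the maximal amount, each of the counts above is an equality, and then so
  are the inclusions from which they were obtained.\<close>
locale tight_maker_turn = maker_turn +
  assumes tight: "budget v0 (A \<union> M) B = budget v0 A B + 2 * card M"
begin

lemma tight_counts:
  "card new_edges = card new"
  "card (stray v0 (A \<union> M)) + card new = card (stray v0 A) + card M"
  "card old_heads + card claimed_heads = card (heads v0 A B)"
  "card new_heads + card new_darts = 4 * card new"
  using tight stray_count old_heads_count new_heads_count new_darts_count new_edges_ge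
  unfolding budget_def card_heads_split by linarith+

lemma old_heads_eq: "old_heads = heads v0 A B - claimed_heads"
proof (rule card_subset_eq)
  show "card old_heads = card (heads v0 A B - claimed_heads)"
    using tight_counts(3) fin_heads claimed_sub
    by (metis add_diff_cancel_right' card_Diff_subset finite_subset)
qed (use fin_heads old_heads_sub in auto)

lemma new_darts_eq: "new_heads \<union> new_darts = {(y, z). y \<in> new \<and> {y, z} \<in> lattice_edges}"
  by (rule card_subset_eq[OF finite_darts[OF fin_new] new_darts_sub])
    (simp add: new_union_card tight_counts card_darts[OF fin_new])

lemma inner_edge_claimed:
  assumes "z \<in> new" "w \<in> component v0 (A \<union> M)" "{z, w} \<in> lattice_edges"
  shows "{z, w} \<in> A \<union> M"
proof -
  have "(z, w) \<in> new_heads \<union> new_darts" using assms new_darts_eq by auto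
  then show ?thesis using assms by (auto simp: new_heads_def new_darts_def heads_def)
qed

lemma outer_edge_head:
  assumes "z \<in> new" "w \<notin> component v0 (A \<union> M)" "{z, w} \<in> lattice_edges"
  shows "(z, w) \<in> new_heads"
proof -
  have "(z, w) \<in> new_heads \<union> new_darts" using assms new_darts_eq by auto
  then show ?thesis using assms component_step[of z v0 "A \<union> M" w] by (auto simp: new_darts_def new_def)
qed

text \<open>A second lattice edge from \<open>z\<close> into the component would have to be a Maker edge, closing a cycle
  through the contracted component.\<close>
lemma one_edge_to_component:
  assumes "(y, z) \<in> claimed_heads" "y' \<in> component v0 A" "{y', z} \<in> lattice_edges"
  shows "y' = y"
proof (rule ccontr)
  assume "y' \<noteq> y"
  note yz = claimed_headsD[OF assms(1)]
  have "{z, y'} \<in> A \<union> M"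
    using inner_edge_claimed[of z y'] assms yz comp_mono by (auto simp: insert_commute)
  then have "card new < card new_edges"
    unfolding new_edges_def using yz assms fin \<open>y' \<noteq> y\<close>
    by (intro attached_two_edges_card_less[OF fin_new _ attached_new, of z y y'])
      (auto simp: insert_commute)
  then show False using tight_counts by simp
qed

text \<open>By the previous lemma \<open>w\<close> is not in the old component. If it were absorbed in this turn, the edges
  from \<open>w\<close> to \<open>x\<close> and \<open>z\<close> would be Maker edges, again closing a cycle.\<close>
lemma corner_outside:
  assumes "(y, z) \<in> claimed_heads" "x \<in> component v0 A" "w \<noteq> y"
    and "{x, w} \<in> lattice_edges" "{w, z} \<in> lattice_edges"
  shows "w \<notin> component v0 (A \<union> M)"
proof
  assume "w \<in> component v0 (A \<union> M)"
  then have w: "w \<in> new"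
    using one_edge_to_component[OF assms(1), of w] assms unfolding new_def by auto
  note yz = claimed_headsD[OF assms(1)]
  have "{w, x} \<in> A \<union> M" "{w, z} \<in> A \<union> M"
    using inner_edge_claimed[OF w, of x] inner_edge_claimed[OF w, of z] assms yz comp_mono
    by (auto simp: insert_commute new_def)
  then have "card new < card new_edges"
    unfolding new_edges_def using yz assms fin w lattice_edge_neq[OF assms(5)]
    by (intro attached_cycle_card_less[OF fin_new _ attached_new, of z w y x])
      (auto simp: insert_commute)
  then show False using tight_counts by simp
qed

end

section \<open>The freedom of a head\<close>

definition doomed :: "vertex set \<Rightarrow> vertex \<Rightarrow> vertex \<Rightarrow> bool" where
  "doomed C y z \<longleftrightarrow> (\<exists>x\<in>C. x \<noteq> y \<and> {x, z} \<in> lattice_edges)"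

text \<open>Once Maker has claimed the head \<open>(y, z)\<close>, a head from \<open>z\<close> to \<open>w\<close> is doomed because of \<open>x\<close>.
  Typically \<open>x\<close> is a neighbour of \<open>y\<close>, and \<open>y, z, w, x\<close> are the corners of a unit square.\<close>
definition cornered :: "vertex set \<Rightarrow> vertex \<Rightarrow> vertex \<Rightarrow> bool" where
  "cornered C y z \<longleftrightarrow> (\<exists>x\<in>C. \<exists>w. w \<noteq> y \<and> {x, w} \<in> lattice_edges \<and> {w, z} \<in> lattice_edges)"

text \<open>0 for doomed, 1 for cornered and 2 for loose heads. The value 0 takes precedence, so a head
  of freedom 1 is cornered but not doomed.\<close>
definition freedom :: "vertex set \<Rightarrow> vertex \<times> vertex \<Rightarrow> nat" where
  "freedom C h = (if doomed C (fst h) (snd h) then 0 else if cornered C (fst h) (snd h) then 1 else 2)"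

definition heads_of_freedom ::
  "nat \<Rightarrow> vertex \<Rightarrow> edge set \<Rightarrow> edge set \<Rightarrow> (vertex \<times> vertex) set" where
  "heads_of_freedom k v0 A B = {h \<in> heads v0 A B. freedom (component v0 A) h = k}"

text \<open>As Maker's component grows, a surviving head can only lose freedom; in particular doomed heads
  stay doomed, and no old head becomes loose.\<close>
lemma freedom_antimono: "C \<subseteq> C' \<Longrightarrow> freedom C' h \<le> freedom C h"
proof -
  assume "C \<subseteq> C'"
  then have "doomed C y z \<Longrightarrow> doomed C' y z" "cornered C y z \<Longrightarrow> cornered C' y z" for y z
    unfolding doomed_def cornered_def by blast+
  then show ?thesis by (simp add: freedom_def)
qed

lemma freedom_le: "freedom C h \<le> 2"
  by (simp add: freedom_def)

lemma finite_heads_of_freedom: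
  "finite A \<Longrightarrow> A \<subseteq> lattice_edges \<Longrightarrow> finite (heads_of_freedom k v0 A B)"
  unfolding heads_of_freedom_def using finite_heads by auto

lemma card_heads_of_freedom_le:
  assumes "finite A" "A \<subseteq> lattice_edges"
  shows "card (heads_of_freedom 0 v0 A B) + card (heads_of_freedom 2 v0 A B) \<le> card (heads v0 A B)"
proof -
  have "card (heads_of_freedom 0 v0 A B) + card (heads_of_freedom 2 v0 A B) =
      card (heads_of_freedom 0 v0 A B \<union> heads_of_freedom 2 v0 A B)"
    using finite_heads_of_freedom[OF assms]
    by (intro card_Un_disjoint[symmetric]) (auto simp: heads_of_freedom_def)
  also have "\<dots> \<le> card (heads v0 A B)"
    using finite_heads[OF assms] by (intro card_mono) (auto simp: heads_of_freedom_def)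
  finally show ?thesis .
qed

context maker_turn
begin

text \<open>A new vertex \<open>y\<close> has a Maker edge to some \<open>p\<close> in the component, and a loose head at \<open>y\<close> must be
  opposite to \<open>p\<close>: any perpendicular head is cornered by \<open>p\<close>.\<close>
lemma inj_new_loose_heads:
  "inj_on fst {h \<in> new_heads. freedom (component v0 (A \<union> M)) h = 2}"
proof (rule inj_onI)
  fix h h' assume hh: "h \<in> {h \<in> new_heads. freedom (component v0 (A \<union> M)) h = 2}"
    "h' \<in> {h \<in> new_heads. freedom (component v0 (A \<union> M)) h = 2}" "fst h = fst h'"
  then obtain y z z' where h: "h = (y, z)" "h' = (y, z')" by (metis prod.collapse)
  have y: "y \<in> new" "z \<notin> component v0 (A \<union> M)" "z' \<notin> component v0 (A \<union> M)"
    "{y, z} \<in> lattice_edges" "{y, z'} \<in> lattice_edges"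
    using hh h by (auto simp: new_heads_def heads_def)
  have "{y} \<subseteq> new" "{y} \<noteq> {}" using y by auto
  then obtain p where "{y, p} \<in> A \<union> M"
    using attached_new unfolding attached_def by (metis singletonD)
  moreover from this have p: "p \<in> component v0 (A \<union> M)"
    using y component_step[of y v0 "A \<union> M" p] by (simp add: new_def)
  ultimately have "{y, p} \<in> lattice_edges" "p \<noteq> z" "p \<noteq> z'" using lat y by auto
  then have "cornered (component v0 (A \<union> M)) y z \<or> cornered (component v0 (A \<union> M)) y z'" if "z \<noteq> z'"
    using two_neighbours_corner[of y p z z'] y p that unfolding cornered_def by blast
  then show "h = h'" using hh h by (auto simp: freedom_def split: if_splits)
qed

lemma loose_count:
  "card (heads_of_freedom 2 v0 (A \<union> M) B) \<le> card (heads_of_freedom 2 v0 A B) + card new"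
proof -
  let ?L = "{h \<in> new_heads. freedom (component v0 (A \<union> M)) h = 2}"
  have "freedom (component v0 A) h = 2" if "freedom (component v0 (A \<union> M)) h = 2" for h
    using freedom_antimono[OF comp_mono, of h] freedom_le[of "component v0 A" h] that by simp
  then have "heads_of_freedom 2 v0 (A \<union> M) B \<subseteq> heads_of_freedom 2 v0 A B \<union> ?L"
    using old_heads_sub heads_split(1) unfolding heads_of_freedom_def by blast
  moreover have fin_L: "finite ?L" using fin_heads heads_split(1) by auto
  ultimately have "card (heads_of_freedom 2 v0 (A \<union> M) B) \<le> card (heads_of_freedom 2 v0 A B \<union> ?L)"
    using finite_heads_of_freedom[OF fin(1) lat(1)] by (intro card_mono) auto
  also have "\<dots> \<le> card (heads_of_freedom 2 v0 A B) + card ?L" by (rule card_Un_le)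
  also have "card ?L \<le> card new"
    by (rule card_inj_on_le[OF inj_new_loose_heads _ fin_new]) (auto simp: new_heads_def)
  finally show ?thesis by simp
qed

end

context tight_maker_turn
begin

lemma claimed_head_not_doomed: "h \<in> claimed_heads \<Longrightarrow> freedom (component v0 A) h \<noteq> 0"
  using one_edge_to_component by (cases h) (auto simp: freedom_def doomed_def)

lemma cornered_claimed_new_doomed:
  assumes "h \<in> claimed_heads" "freedom (component v0 A) h = 1"
  shows "\<exists>h'\<in>new_heads. freedom (component v0 (A \<union> M)) h' = 0"
proof -
  obtain y z where h: "h = (y, z)" by (cases h)
  then obtain x w where xw: "x \<in> component v0 A" "w \<noteq> y" "{x, w} \<in> lattice_edges"
    "{w, z} \<in> lattice_edges"
    using assms(2) by (auto simp: freedom_def cornered_def split: if_splits)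
  have w: "w \<notin> component v0 (A \<union> M)" using corner_outside assms(1) xw unfolding h by blast
  have z: "z \<in> new" using assms(1) h claimed_headsD by blast
  then have "(z, w) \<in> new_heads" using outer_edge_head w xw(4) by (simp add: insert_commute)
  moreover have "x \<noteq> z" using z xw(1) by (auto simp: new_def)
  then have "doomed (component v0 (A \<union> M)) z w"
    using xw comp_mono unfolding doomed_def by blast
  ultimately show ?thesis by (force simp: freedom_def)
qed

lemma old_doomed_sub:
  "heads_of_freedom 0 v0 A B \<subseteq> heads_of_freedom 0 v0 (A \<union> M) B \<inter> old_heads"
proof
  fix h assume h: "h \<in> heads_of_freedom 0 v0 A B"
  then have "h \<in> old_heads"
    using claimed_head_not_doomed[of h] by (auto simp: old_heads_eq heads_of_freedom_def)
  moreover have "freedom (component v0 (A \<union> M)) h = 0"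
    using h freedom_antimono[OF comp_mono, of h] by (simp add: heads_of_freedom_def)
  ultimately show "h \<in> heads_of_freedom 0 v0 (A \<union> M) B \<inter> old_heads"
    using heads_split(1) by (auto simp: heads_of_freedom_def)
qed

lemma doomed_count: "card (heads_of_freedom 0 v0 A B) \<le> card (heads_of_freedom 0 v0 (A \<union> M) B)"
  using old_doomed_sub fin lat by (intro card_mono finite_heads_of_freedom) auto

lemma doomed_count_increase:
  assumes "h \<in> claimed_heads" "freedom (component v0 A) h = 1"
  shows "card (heads_of_freedom 0 v0 A B) < card (heads_of_freedom 0 v0 (A \<union> M) B)"
proof -
  obtain h' where h': "h' \<in> new_heads" "freedom (component v0 (A \<union> M)) h' = 0"
    using cornered_claimed_new_doomed[OF assms] by blast
  then have "h' \<in> heads_of_freedom 0 v0 (A \<union> M) B" "h' \<notin> old_heads"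
    using heads_split by (auto simp: heads_of_freedom_def)
  then have "heads_of_freedom 0 v0 A B \<subset> heads_of_freedom 0 v0 (A \<union> M) B"
    using old_doomed_sub by blast
  then show ?thesis using fin lat by (intro psubset_card_mono finite_heads_of_freedom) auto
qed

lemma idle_turn:
  assumes "claimed_heads = {}"
  shows "component v0 (A \<union> M) = component v0 A" "heads v0 (A \<union> M) B = heads v0 A B"
    "card (stray v0 (A \<union> M)) = card (stray v0 A) + card M"
proof -
  have new: "new = {}" using assms by (rule no_claimed_heads)
  then show c: "component v0 (A \<union> M) = component v0 A" using comp_mono by (auto simp: new_def)
  then show "heads v0 (A \<union> M) B = heads v0 A B" by (simp add: heads_def)
  show "card (stray v0 (A \<union> M)) = card (stray v0 A) + card M"
    using tight_counts(2) new by simp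
qed

end

section \<open>Breaker's reply\<close>

text \<open>Only containment of \<open>P\<close> in \<open>K\<close> is required, as Breaker may have to claim further edges to complete
  his move.\<close>
definition greedy :: "vertex \<Rightarrow> edge set \<Rightarrow> edge set \<Rightarrow> nat \<Rightarrow> edge set \<Rightarrow> bool" where
  "greedy v0 A B k K \<longleftrightarrow> (\<exists>P\<subseteq>heads v0 A B. (\<forall>(y, z)\<in>P. {y, z} \<in> K) \<and>
     (P = heads v0 A B \<or> card P = k \<and>
       (\<forall>p\<in>P. \<forall>q\<in>heads v0 A B - P. freedom (component v0 A) q \<le> freedom (component v0 A) p)))"

lemma top_subset:
  fixes f :: "'a \<Rightarrow> nat"
  assumes "finite S" "k \<le> card S"
  shows "\<exists>P\<subseteq>S. card P = k \<and> (\<forall>p\<in>P. \<forall>q\<in>S - P. f q \<le> f p)"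
  using assms(2)
proof (induction k)
  case 0
  show ?case by (intro exI[of _ "{}"]) simp
next
  case (Suc k)
  then obtain P where P: "P \<subseteq> S" "card P = k" "\<forall>p\<in>P. \<forall>q\<in>S - P. f q \<le> f p" by auto
  have fin: "finite P" "finite (S - P)" using P(1) assms(1) finite_subset by auto
  have ne: "S - P \<noteq> {}" using P Suc.prems by auto
  have "Max (f ` (S - P)) \<in> f ` (S - P)" using fin ne by (intro Max_in) auto
  then obtain s where s: "s \<in> S - P" "f s = Max (f ` (S - P))" by auto
  then have "\<forall>q\<in>S - P. f q \<le> f s" using fin by simp
  then show ?case using P s(1) fin by (intro exI[of _ "insert s P"]) auto
qed

text \<open>A chosen set of at most \<open>k\<close> heads is filled up to \<open>b\<close> edges from the infinitely many free ones.\<close>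
lemma greedy_reply_exists:
  assumes "finite A" "A \<subseteq> lattice_edges" "finite B" "k \<le> b"
  shows "\<exists>K. K \<subseteq> lattice_edges - (A \<union> B) \<and> finite K \<and> card K = b \<and> greedy v0 A B k K"
proof -
  let ?H = "heads v0 A B"
  let ?f = "freedom (component v0 A)"
  have fin: "finite ?H" using assms(1,2) by (rule finite_heads)
  obtain P where P: "P \<subseteq> ?H" "card P \<le> k"
    "P = ?H \<or> card P = k \<and> (\<forall>p\<in>P. \<forall>q\<in>?H - P. ?f q \<le> ?f p)"
  proof (cases "k \<le> card ?H")
    case True
    then show thesis using top_subset[OF fin True, of ?f] that by auto
  next
    case False
    then show thesis using that[of ?H] by simp
  qed
  define K0 where "K0 = (\<lambda>(y, z). {y, z}) ` P"
  have finP: "finite P" using P(1) fin finite_subset by blast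
  then have K0: "finite K0" "card K0 \<le> b"
    using card_image_le[of P "\<lambda>(y, z). {y, z}"] P(2) assms(4) by (simp_all add: K0_def)
  have K0_sub: "K0 \<subseteq> lattice_edges - (A \<union> B)"
    using P(1) component_step[of _ v0 A] by (force simp: K0_def heads_def)
  \<comment> \<open>The remaining claims are arbitrary: a further lost head would only lower the budget.\<close>
  have "infinite (lattice_edges - (A \<union> B) - K0)"
    using infinite_lattice_edges assms K0(1) by (simp add: Diff_infinite_finite)
  then obtain K1 where K1: "finite K1" "card K1 = b - card K0" "K1 \<subseteq> lattice_edges - (A \<union> B) - K0"
    using infinite_arbitrarily_large by metis
  then have "card (K0 \<union> K1) = b" using K0 by (subst card_Un_disjoint) auto
  moreover have "greedy v0 A B k (K0 \<union> K1)"
    unfolding greedy_def using P by (intro exI[of _ P]) (auto simp: K0_def)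
  ultimately show ?thesis using K0 K0_sub K1 by (intro exI[of _ "K0 \<union> K1"]) auto
qed

lemma greedyE:
  assumes "greedy v0 A B k K" "heads v0 A (B \<union> K) \<noteq> {}"
  obtains P where "P \<subseteq> heads v0 A B" "card P = k" "heads v0 A (B \<union> K) \<subseteq> heads v0 A B - P"
    "\<And>p q. p \<in> P \<Longrightarrow> q \<in> heads v0 A B - P \<Longrightarrow>
      freedom (component v0 A) q \<le> freedom (component v0 A) p"
proof -
  obtain P where P: "P \<subseteq> heads v0 A B" "\<forall>(y, z)\<in>P. {y, z} \<in> K"
    "P = heads v0 A B \<or> card P = k \<and>
      (\<forall>p\<in>P. \<forall>q\<in>heads v0 A B - P. freedom (component v0 A) q \<le> freedom (component v0 A) p)"
    using assms(1) unfolding greedy_def by blast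
  have sub: "heads v0 A (B \<union> K) \<subseteq> heads v0 A B - P" using P(2) by (auto simp: heads_def)
  then have "P \<noteq> heads v0 A B" using assms(2) by blast
  then show thesis using that P sub by blast
qed

lemma greedy_budget_decrease:
  assumes "greedy v0 A B k K" "heads v0 A (B \<union> K) \<noteq> {}" "finite A" "A \<subseteq> lattice_edges"
  shows "budget v0 A (B \<union> K) + k \<le> budget v0 A B"
proof -
  obtain P where P: "P \<subseteq> heads v0 A B" "card P = k" "heads v0 A (B \<union> K) \<subseteq> heads v0 A B - P"
    using greedyE[OF assms(1,2)] by metis
  have fin: "finite (heads v0 A B)" using assms(3,4) by (rule finite_heads)
  have "card (heads v0 A (B \<union> K)) \<le> card (heads v0 A B) - k"
    using card_mono[OF _ P(3)] fin P(1,2) by (simp add: card_Diff_subset finite_subset)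
  moreover have "k \<le> card (heads v0 A B)" using P(1,2) fin card_mono by blast
  ultimately show ?thesis unfolding budget_def by linarith
qed

locale game_round = maker_turn +
  fixes m :: nat and K :: "edge set"
  assumes card_M: "card M = m"
    and greedy_K: "greedy v0 (A \<union> M) B (2 * m) K"
    and alive: "heads v0 (A \<union> M) (B \<union> K) \<noteq> {}"
begin

lemma fin': "finite (A \<union> M)" "A \<union> M \<subseteq> lattice_edges"
  using fin lat by auto

lemma budget_nonincreasing: "budget v0 (A \<union> M) (B \<union> K) \<le> budget v0 A B"
  using greedy_budget_decrease[OF greedy_K alive fin'] budget_increase card_M by linarith

end

text \<open>A round in which Maker's turn and Breaker's reply leave the budget unchanged. Then Maker's turn is
  tight, and Breaker's move removes no head besides the greedy choice \<open>P\<close>.\<close>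
locale tight_round = game_round +
  assumes same_budget: "budget v0 (A \<union> M) (B \<union> K) = budget v0 A B"

sublocale tight_round \<subseteq> tight_maker_turn
  using greedy_budget_decrease[OF greedy_K alive fin'] budget_increase card_M same_budget
  by unfold_locales linarith

context tight_round
begin

lemma reply_heads:
  obtains P where "P \<subseteq> heads v0 (A \<union> M) B" "card P = 2 * m"
    "heads v0 (A \<union> M) (B \<union> K) = heads v0 (A \<union> M) B - P"
    "\<And>p q. p \<in> P \<Longrightarrow> q \<in> heads v0 (A \<union> M) (B \<union> K) \<Longrightarrow>
      freedom (component v0 (A \<union> M)) q \<le> freedom (component v0 (A \<union> M)) p"
proof -
  obtain P where P: "P \<subseteq> heads v0 (A \<union> M) B" "card P = 2 * m"
    "heads v0 (A \<union> M) (B \<union> K) \<subseteq> heads v0 (A \<union> M) B - P"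
    "\<And>p q. p \<in> P \<Longrightarrow> q \<in> heads v0 (A \<union> M) B - P \<Longrightarrow>
      freedom (component v0 (A \<union> M)) q \<le> freedom (component v0 (A \<union> M)) p"
    using greedyE[OF greedy_K alive] by metis
  have "card (heads v0 (A \<union> M) (B \<union> K)) + 2 * m = card (heads v0 (A \<union> M) B)"
    using tight same_budget card_M unfolding budget_def by linarith
  then have "card (heads v0 (A \<union> M) (B \<union> K)) = card (heads v0 (A \<union> M) B - P)"
    using P(1,2) fin_heads(2) by (simp add: card_Diff_subset finite_subset)
  then have "heads v0 (A \<union> M) (B \<union> K) = heads v0 (A \<union> M) B - P"
    using P(3) fin_heads(2) by (intro card_subset_eq) auto
  then show thesis using that P by metis
qed

text \<open>If a head that is not doomed survives, the priorities of the greedy choice have spared all doomed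
  heads.\<close>
lemma doomed_heads_kept:
  assumes "h \<in> heads v0 (A \<union> M) (B \<union> K)" "0 < freedom (component v0 (A \<union> M)) h"
  shows "heads_of_freedom 0 v0 (A \<union> M) (B \<union> K) = heads_of_freedom 0 v0 (A \<union> M) B"
proof -
  obtain P where P: "heads v0 (A \<union> M) (B \<union> K) = heads v0 (A \<union> M) B - P"
    "\<And>p q. p \<in> P \<Longrightarrow> q \<in> heads v0 (A \<union> M) (B \<union> K) \<Longrightarrow>
      freedom (component v0 (A \<union> M)) q \<le> freedom (component v0 (A \<union> M)) p"
    using reply_heads by metis
  have "0 < freedom (component v0 (A \<union> M)) p" if "p \<in> P" for p
    using P(2)[OF that assms(1)] assms(2) by linarith
  then show ?thesis unfolding heads_of_freedom_def P(1) by fastforce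
qed

lemma doomed_nondecreasing:
  assumes "h \<in> heads v0 (A \<union> M) (B \<union> K)" "0 < freedom (component v0 (A \<union> M)) h"
  shows "card (heads_of_freedom 0 v0 A B) \<le> card (heads_of_freedom 0 v0 (A \<union> M) (B \<union> K))"
  using doomed_heads_kept[OF assms] doomed_count by simp

lemma doomed_increasing:
  assumes "h \<in> heads v0 (A \<union> M) (B \<union> K)" "0 < freedom (component v0 (A \<union> M)) h"
    and "h' \<in> claimed_heads" "freedom (component v0 A) h' = 1"
  shows "card (heads_of_freedom 0 v0 A B) < card (heads_of_freedom 0 v0 (A \<union> M) (B \<union> K))"
  using doomed_heads_kept[OF assms(1,2)] doomed_count_increase[OF assms(3,4)] by simp

text \<open>If a loose head survives, all \<open>2 * m\<close> heads of the greedy choice are loose. With \<open>n\<close> new vertices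
  Maker gains at most \<open>n\<close> loose heads and \<open>m - n\<close> stray edges, so the sum changes by at most
  \<open>n + (m - n) - 2 * m\<close>.\<close>
lemma loose_decreasing:
  assumes "heads_of_freedom 2 v0 (A \<union> M) (B \<union> K) \<noteq> {}"
  shows "card (heads_of_freedom 2 v0 (A \<union> M) (B \<union> K)) + card (stray v0 (A \<union> M)) + m
    \<le> card (heads_of_freedom 2 v0 A B) + card (stray v0 A)"
proof -
  let ?f = "freedom (component v0 (A \<union> M))"
  obtain P where P: "P \<subseteq> heads v0 (A \<union> M) B" "card P = 2 * m"
    "heads v0 (A \<union> M) (B \<union> K) = heads v0 (A \<union> M) B - P"
    "\<And>p q. p \<in> P \<Longrightarrow> q \<in> heads v0 (A \<union> M) (B \<union> K) \<Longrightarrow> ?f q \<le> ?f p"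
    using reply_heads by metis
  obtain q where q: "q \<in> heads v0 (A \<union> M) (B \<union> K)" "?f q = 2"
    using assms by (auto simp: heads_of_freedom_def)
  have "?f p = 2" if "p \<in> P" for p
    using P(4)[OF that q(1)] q(2) freedom_le[of "component v0 (A \<union> M)" p] by simp
  then have sub: "P \<subseteq> heads_of_freedom 2 v0 (A \<union> M) B" using P(1) by (auto simp: heads_of_freedom_def)
  have eq: "heads_of_freedom 2 v0 (A \<union> M) (B \<union> K) = heads_of_freedom 2 v0 (A \<union> M) B - P"
    by (auto simp: heads_of_freedom_def P(3))
  have finL: "finite (heads_of_freedom 2 v0 (A \<union> M) B)" using fin' by (rule finite_heads_of_freedom)
  have "card (heads_of_freedom 2 v0 (A \<union> M) (B \<union> K)) + 2 * m = card (heads_of_freedom 2 v0 (A \<union> M) B)"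
    unfolding eq using sub finL P(2) card_mono[OF finL sub] by (simp add: card_Diff_subset finite_subset)
  then show ?thesis using loose_count tight_counts(2) card_M by linarith
qed

text \<open>Doomed heads cannot be claimed in a tight round. So if there are no loose heads and no cornered one
  is claimed, the component does not grow and all of Maker's edges are stray.\<close>
lemma idle_round:
  assumes "\<And>h. h \<in> claimed_heads \<Longrightarrow> freedom (component v0 A) h \<noteq> 1"
    and "heads_of_freedom 2 v0 A B = {}"
  shows "component v0 (A \<union> M) = component v0 A"
    "heads v0 (A \<union> M) (B \<union> K) \<subseteq> heads v0 A B"
    "card (stray v0 (A \<union> M)) = card (stray v0 A) + m"
proof -
  have "freedom (component v0 A) h = 0 \<or> freedom (component v0 A) h = 1 \<or> freedom (component v0 A) h = 2" for h
    by (simp add: freedom_def)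
  then have "claimed_heads = {}"
    using assms claimed_head_not_doomed claimed_sub unfolding heads_of_freedom_def by blast
  note idle = idle_turn[OF this]
  show "component v0 (A \<union> M) = component v0 A" by (fact idle)
  show "heads v0 (A \<union> M) (B \<union> K) \<subseteq> heads v0 A B" using idle(1) by (auto simp: heads_def)
  show "card (stray v0 (A \<union> M)) = card (stray v0 A) + m" using idle card_M by simp
qed

end

section \<open>The potential\<close>

text \<open>With budget \<open>u\<close> and at least one head there are at most \<open>(u - 1) div 2\<close> stray edges. So, with \<open>W\<close>
  stray edges present, Maker can spend at most this many tight rounds on stray edges alone.\<close>
definition waiting_time :: "nat \<Rightarrow> nat \<Rightarrow> nat \<Rightarrow> nat" where
  "waiting_time m u W = ((u - 1) div 2 - W) div m"

text \<open>A phase of a stage of constant budget \<open>u\<close> ends when the number of doomed heads grows. Here \<open>D\<close> is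
  the budget minus that number, so that at most \<open>D - 1\<close> phases lie ahead before all heads are
  doomed, and \<open>waiting_time m u 0 + 1\<close> accounts for the final wait after that. In each of these
  later phases the sum of loose heads and stray edges starts at \<open>u - 1\<close> or less and loses \<open>m\<close>
  per round, which takes at most \<open>(u - 2) div m + 1\<close> rounds until the loose heads are gone;
  then follow at most \<open>waiting_time m u 0\<close> idle rounds, and the last one.\<close>
definition phases_time :: "nat \<Rightarrow> nat \<Rightarrow> nat \<Rightarrow> nat" where
  "phases_time m u D = waiting_time m u 0 + 1 + (D - 1) * (waiting_time m u 0 + 2 + (u - 2) div m)"

text \<open>A bound for the number of tight rounds still possible at budget \<open>u\<close>, where \<open>live\<close> says that some
  head is not doomed, \<open>t\<close> is the number of loose heads and \<open>W\<close> the number of stray edges. If no head is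
  live, Maker can only add stray edges; if none is loose, the current phase consists of waiting;
  otherwise the loose heads have to be used up before that.\<close>
definition stage_time :: "nat \<Rightarrow> nat \<Rightarrow> bool \<Rightarrow> nat \<Rightarrow> nat \<Rightarrow> nat \<Rightarrow> nat" where
  "stage_time m u live D t W =
    (if \<not> live then waiting_time m u W
     else if t = 0 then phases_time m u D + waiting_time m u W
     else phases_time m u D + waiting_time m u 0 + 1 + (t + W - 1) div m)"

lemma waiting_time_le: "waiting_time m u W \<le> waiting_time m u 0"
  unfolding waiting_time_def by (simp add: div_le_mono)

lemma waiting_time_less:
  assumes "0 < m" "2 * (W + m) < u"
  shows "waiting_time m u (W + m) < waiting_time m u W"
proof -
  have "W + m = 2 * (W + m) div 2" by simp
  also have "\<dots> \<le> (u - 1) div 2" using assms(2) by (intro div_le_mono) linarith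
  finally have "m \<le> (u - 1) div 2 - W" by linarith
  then show ?thesis using assms(1) unfolding waiting_time_def
    by (simp add: le_div_geq)
qed

lemma phases_time_mono: "D \<le> D' \<Longrightarrow> phases_time m u D \<le> phases_time m u D'"
  unfolding phases_time_def by (intro add_left_mono mult_le_mono1) simp

lemma phases_time_less:
  assumes "0 < D" "D < D'"
  shows "phases_time m u D + waiting_time m u 0 + 2 + (u - 2) div m \<le> phases_time m u D'"
proof -
  have "(D - 1) * (waiting_time m u 0 + 2 + (u - 2) div m) + (waiting_time m u 0 + 2 + (u - 2) div m)
      = D * (waiting_time m u 0 + 2 + (u - 2) div m)"
    using assms(1) by (cases D) simp_all
  also have "\<dots> \<le> (D' - 1) * (waiting_time m u 0 + 2 + (u - 2) div m)"
    using assms by (intro mult_le_mono1) simp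
  finally show ?thesis unfolding phases_time_def by linarith
qed

lemma stage_time_less_phase:
  assumes "0 < D" "D < D'" "t + W \<le> D" "D' \<le> u"
  shows "stage_time m u live D t W < phases_time m u D'"
proof -
  have "(t + W - 1) div m \<le> (u - 2) div m" using assms by (intro div_le_mono) linarith
  then show ?thesis
    using phases_time_less[OF assms(1,2), of m u] waiting_time_le[of m u W]
    unfolding stage_time_def by auto
qed

lemma stage_time_ge: "live \<Longrightarrow> phases_time m u D \<le> stage_time m u live D t W"
  unfolding stage_time_def by simp

text \<open>The hypothesis \<open>cases\<close> describes a tight round: either a cornered head was claimed, so that \<open>D\<close>
  drops unless all surviving heads are doomed, or not, and then the round is idle if no head was
  loose.\<close>
lemma stage_time_decreases:
  assumes m: "0 < m" and W': "2 * W' < u" and D: "D \<le> u"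
    and t': "live' \<Longrightarrow> 0 < D' \<and> t' + W' \<le> D'"
    and t_live: "0 < t \<Longrightarrow> live"
    and cases: "live \<and> (live' \<longrightarrow> D' < D) \<or>
      (live' \<longrightarrow> D' \<le> D) \<and> (t = 0 \<longrightarrow> W' = W + m \<and> t' = 0 \<and> (live' \<longrightarrow> live))"
    and loose: "0 < t' \<Longrightarrow> t' + W' + m \<le> t + W"
  shows "stage_time m u live' D' t' W' < stage_time m u live D t W"
proof (cases live')
  case False
  show ?thesis
  proof (cases live)
    case True
    have "waiting_time m u W' < phases_time m u D"
      using waiting_time_le[of m u W'] by (simp add: phases_time_def)
    then show ?thesis
      using stage_time_ge[OF True, of m u D t W] False by (simp add: stage_time_def)
  next
    case nl: False
    then have "W' = W + m" using cases t_live by auto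
    then show ?thesis using nl False waiting_time_less[OF m, of W u] W' by (simp add: stage_time_def)
  qed
next
  case True
  show ?thesis
  proof (cases "live \<and> D' < D")
    case less: True
    have "stage_time m u live' D' t' W' < phases_time m u D"
      using t'[OF True] less D by (intro stage_time_less_phase) auto
    then show ?thesis using stage_time_ge[of live m u D t W] less by linarith
  next
    case nless: False
    then have DD: "D' \<le> D" and idle: "t = 0 \<Longrightarrow> W' = W + m \<and> t' = 0 \<and> live"
      using cases True by auto
    have live: live using idle t_live by auto
    note ph = phases_time_mono[OF DD, of m u]
    consider "t = 0" | "0 < t" "t' = 0" | "0 < t'" "0 < t" using idle by auto
    then show ?thesis
    proof cases
      case 1
      then have "W' = W + m" "t' = 0" using idle by auto
      then show ?thesis
        using 1 True live ph waiting_time_less[OF m, of W u] W' by (simp add: stage_time_def)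
    next
      case 2
      then show ?thesis
        using True live ph waiting_time_le[of m u W'] by (simp add: stage_time_def)
    next
      case 3
      have "(t' + W' - 1) div m + 1 = (t' + W' - 1 + m) div m" using m by simp
      also have "\<dots> \<le> (t + W - 1) div m" using loose 3 by (intro div_le_mono) linarith
      finally show ?thesis using 3 True live ph by (simp add: stage_time_def)
    qed
  qed
qed

text \<open>With \<open>q\<close> bounding \<open>(2 * c + 2) div m\<close>, a phase takes at most about \<open>3 / 2 * q + 2\<close> rounds: up to \<open>q\<close>
  of them to use up the loose heads, and up to \<open>q / 2\<close> idle ones. So \<open>u\<close> phases and the final wait
  fit into \<open>2 * u * (q + 1)\<close> rounds, but with little room to spare when \<open>u\<close> is small. The bound is
  strict with a margin of one, to compensate for the final position of potential 0.\<close>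
lemma stage_time_bound:
  assumes m: "0 < m" and u: "0 < u" "u \<le> 2 * c + 4" and D: "D \<le> u" "t + W \<le> u"
    and q: "(2 * c + 2) div m \<le> q" "1 \<le> q"
  shows "stage_time m u live D t W + 1 < 2 * u * (q + 1)"
proof -
  define G where "G = waiting_time m u 0"
  define h where "h = (u - 2) div m"
  have G_eq: "G = (u - 1) div 2 div m" by (simp add: G_def waiting_time_def)
  have "2 * G * m \<le> 2 * ((u - 1) div 2)"
    using div_times_less_eq_dividend[of "(u - 1) div 2" m] by (simp add: G_eq)
  then have "2 * G \<le> (2 * ((u - 1) div 2)) div m" using m by (simp add: less_eq_div_iff_mult_less_eq)
  also have "\<dots> \<le> (2 * c + 2) div m" using u by (intro div_le_mono) presburger
  finally have G: "2 * G \<le> q" using q by linarith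
  have "h \<le> (2 * c + 2) div m" unfolding h_def using u by (intro div_le_mono) linarith
  then have h: "h \<le> q" using q by linarith
  \<comment> \<open>The initial phase of a stage may have \<open>t + W = u\<close>, which costs one round more than later phases.\<close>
  have "(t + W - 1) div m \<le> (u - 2 + m) div m" using D m u by (intro div_le_mono) linarith
  then have h1: "(t + W - 1) div m \<le> h + 1" using m by (simp add: h_def)
  have "stage_time m u live D t W \<le> phases_time m u u + G + 1 + (h + 1)"
    using phases_time_mono[OF D(1), of m u] waiting_time_le[of m u W] h1
    unfolding stage_time_def G_def by auto
  also have "\<dots> = 1 + G + u * (G + 2 + h)"
  proof -
    obtain u' where "u = Suc u'" using u by (cases u) auto
    then show ?thesis unfolding phases_time_def G_def[symmetric] h_def[symmetric] by simp
  qed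
  finally have le: "stage_time m u live D t W \<le> 1 + G + u * (G + 2 + h)" .
  consider "u = 1" | "u = 2" | "u = 3" | "4 \<le> u" using u by linarith
  then show ?thesis
  proof cases
    case 1
    then have "stage_time m u live D t W \<le> 2"
      using D waiting_time_le[of m u W] unfolding stage_time_def phases_time_def
      by (auto simp: waiting_time_def)
    then show ?thesis using 1 q by simp
  next
    case 2
    then have "G = 0" "h = 0" by (simp_all add: G_eq h_def)
    then show ?thesis using le 2 q by simp
  next
    case 3
    then have "h = G" by (simp add: G_eq h_def)
    moreover have "G \<le> 1" using 3 by (simp add: G_eq div_le_dividend)
    ultimately show ?thesis using le 3 G q by (cases "G = 0") auto
  next
    case 4
    have "3 + G + u * G \<le> u * q"
    proof (cases "G = 0")
      case True
      have "4 * 1 \<le> u * q" using 4 q by (intro mult_mono) auto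
      then show ?thesis using True by simp
    next
      case False
      have "u * (2 * G) \<le> u * q" using G by simp
      moreover have "4 * G \<le> u * G" using 4 by simp
      ultimately show ?thesis using False by linarith
    qed
    moreover have "u * h \<le> u * q" using h by simp
    moreover have "u * (G + 2 + h) = u * G + 2 * u + u * h" "2 * u * (q + 1) = u * q + u * q + 2 * u"
      by (simp_all add: algebra_simps)
    ultimately show ?thesis using le by linarith
  qed
qed

definition live :: "vertex \<Rightarrow> edge set \<Rightarrow> edge set \<Rightarrow> bool" where
  "live v0 A B \<longleftrightarrow> (\<exists>h\<in>heads v0 A B. 0 < freedom (component v0 A) h)"

definition remaining_time :: "nat \<Rightarrow> vertex \<Rightarrow> edge set \<Rightarrow> edge set \<Rightarrow> nat" where
  "remaining_time m v0 A B = stage_time m (budget v0 A B) (live v0 A B)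
     (budget v0 A B - card (heads_of_freedom 0 v0 A B))
     (card (heads_of_freedom 2 v0 A B)) (card (stray v0 A))"

lemma loose_le_slack:
  assumes "finite A" "A \<subseteq> lattice_edges"
  shows "card (heads_of_freedom 2 v0 A B) + card (stray v0 A)
    \<le> budget v0 A B - card (heads_of_freedom 0 v0 A B)"
  using card_heads_of_freedom_le[OF assms, of v0 B] unfolding budget_def by linarith

lemma live_slack_pos:
  assumes "finite A" "A \<subseteq> lattice_edges" "live v0 A B"
  shows "0 < budget v0 A B - card (heads_of_freedom 0 v0 A B)"
proof -
  obtain h where h: "h \<in> heads v0 A B" "0 < freedom (component v0 A) h"
    using assms(3) unfolding live_def by blast
  then have "h \<notin> heads_of_freedom 0 v0 A B" by (simp add: heads_of_freedom_def)
  with h(1) have "heads_of_freedom 0 v0 A B \<subset> heads v0 A B"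
    unfolding heads_of_freedom_def by blast
  then have "card (heads_of_freedom 0 v0 A B) < card (heads v0 A B)"
    using finite_heads[OF assms(1,2)] psubset_card_mono by blast
  then show ?thesis unfolding budget_def by linarith
qed

lemma (in tight_round) remaining_time_decreases:
  assumes "0 < m"
  shows "remaining_time m v0 (A \<union> M) (B \<union> K) < remaining_time m v0 A B"
  unfolding remaining_time_def same_budget
proof (rule stage_time_decreases[OF assms])
  show "2 * card (stray v0 (A \<union> M)) < budget v0 A B"
  proof -
    have "0 < card (heads v0 (A \<union> M) (B \<union> K))"
      using alive finite_heads[OF fin', of v0 "B \<union> K"] by (simp add: card_gt_0_iff)
    then show ?thesis using same_budget unfolding budget_def by linarith
  qed
  show "0 < budget v0 A B - card (heads_of_freedom 0 v0 (A \<union> M) (B \<union> K)) \<and>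
      card (heads_of_freedom 2 v0 (A \<union> M) (B \<union> K)) + card (stray v0 (A \<union> M))
      \<le> budget v0 A B - card (heads_of_freedom 0 v0 (A \<union> M) (B \<union> K))"
    if "live v0 (A \<union> M) (B \<union> K)"
    using live_slack_pos[OF fin' that] loose_le_slack[OF fin', of v0 "B \<union> K"]
    unfolding same_budget by simp
  show "live v0 A B" if "0 < card (heads_of_freedom 2 v0 A B)"
  proof -
    have "heads_of_freedom 2 v0 A B \<noteq> {}" using that by (simp add: card_gt_0_iff)
    then obtain h where "h \<in> heads_of_freedom 2 v0 A B" by blast
    then show ?thesis unfolding live_def heads_of_freedom_def by (intro bexI[of _ h]) auto
  qed
  show "card (heads_of_freedom 2 v0 (A \<union> M) (B \<union> K)) + card (stray v0 (A \<union> M)) + m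
      \<le> card (heads_of_freedom 2 v0 A B) + card (stray v0 A)"
    if "0 < card (heads_of_freedom 2 v0 (A \<union> M) (B \<union> K))"
    using that by (intro loose_decreasing) (auto simp: card_gt_0_iff)
  let ?D = "budget v0 A B - card (heads_of_freedom 0 v0 A B)"
  let ?D' = "budget v0 A B - card (heads_of_freedom 0 v0 (A \<union> M) (B \<union> K))"
  let ?live' = "live v0 (A \<union> M) (B \<union> K)"
  show "live v0 A B \<and> (?live' \<longrightarrow> ?D' < ?D) \<or>
      (?live' \<longrightarrow> ?D' \<le> ?D) \<and> (card (heads_of_freedom 2 v0 A B) = 0 \<longrightarrow>
        card (stray v0 (A \<union> M)) = card (stray v0 A) + m \<and>
        card (heads_of_freedom 2 v0 (A \<union> M) (B \<union> K)) = 0 \<and> (?live' \<longrightarrow> live v0 A B))"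
  proof (cases "\<exists>h\<in>claimed_heads. freedom (component v0 A) h = 1")
    case True
    then obtain h where h: "h \<in> claimed_heads" "freedom (component v0 A) h = 1" by blast
    then have "live v0 A B" using claimed_sub unfolding live_def by (intro bexI[of _ h]) auto
    moreover have "?D' < ?D" if live': ?live'
    proof -
      obtain h' where "h' \<in> heads v0 (A \<union> M) (B \<union> K)" "0 < freedom (component v0 (A \<union> M)) h'"
        using live' unfolding live_def by blast
      then show ?thesis
        using doomed_increasing[OF _ _ h, of h'] live_slack_pos[OF fin(1) lat(1) \<open>live v0 A B\<close>]
        by linarith
    qed
    ultimately show ?thesis by blast
  next
    case False
    have "?D' \<le> ?D" if live': ?live'
    proof -
      obtain h where "h \<in> heads v0 (A \<union> M) (B \<union> K)" "0 < freedom (component v0 (A \<union> M)) h"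
        using live' unfolding live_def by blast
      then show ?thesis using doomed_nondecreasing[of h] by linarith
    qed
    moreover have "card (stray v0 (A \<union> M)) = card (stray v0 A) + m \<and>
        card (heads_of_freedom 2 v0 (A \<union> M) (B \<union> K)) = 0 \<and> (?live' \<longrightarrow> live v0 A B)"
      if "card (heads_of_freedom 2 v0 A B) = 0"
    proof -
      have none: "heads_of_freedom 2 v0 A B = {}"
        using that finite_heads_of_freedom[OF fin(1) lat(1)] by simp
      have "freedom (component v0 A) h \<noteq> 1" if "h \<in> claimed_heads" for h
        using False that by blast
      note idle = idle_round[OF this none]
      have "heads_of_freedom 2 v0 (A \<union> M) (B \<union> K) = {}"
        using none idle(1,2) unfolding heads_of_freedom_def by auto
      then show ?thesis using idle unfolding live_def by auto
    qed
    ultimately show ?thesis by blast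
  qed
qed simp

text \<open>With \<open>T = q + 1\<close>, a budget \<open>v\<close> takes up \<open>2 * v * T\<close> rounds; the first summand is the sum of
  these values over all \<open>v\<close> below the current budget.\<close>
definition potential :: "nat \<Rightarrow> nat \<Rightarrow> vertex \<Rightarrow> edge set \<Rightarrow> edge set \<Rightarrow> nat" where
  "potential m T v0 A B = budget v0 A B * (budget v0 A B - 1) * T + remaining_time m v0 A B"

lemma potential_bound:
  assumes "0 < m" "finite A" "A \<subseteq> lattice_edges" "heads v0 A B \<noteq> {}"
    and u: "budget v0 A B \<le> u" "u \<le> 2 * c + 4" and q: "(2 * c + 2) div m \<le> q" "1 \<le> q"
  shows "potential m (q + 1) v0 A B + 1 < u * (u + 1) * (q + 1)"
proof -
  let ?u = "budget v0 A B"
  have pos: "0 < ?u"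
    using assms(4) finite_heads[OF assms(2,3), of v0 B] unfolding budget_def
    by (simp add: card_gt_0_iff)
  have "remaining_time m v0 A B + 1 < 2 * ?u * (q + 1)"
    unfolding remaining_time_def
    using loose_le_slack[OF assms(2,3), of v0 B] u pos q assms(1)
    by (intro stage_time_bound[of m ?u c]) auto
  then have "potential m (q + 1) v0 A B + 1 < ?u * (?u - 1) * (q + 1) + 2 * ?u * (q + 1)"
    unfolding potential_def by simp
  also have "\<dots> = ?u * (?u + 1) * (q + 1)"
    using pos by (cases ?u) (simp_all add: algebra_simps)
  also have "\<dots> \<le> u * (u + 1) * (q + 1)" using u(1) by (intro mult_le_mono) auto
  finally show ?thesis .
qed

text \<open>If the budget drops, the new potential is bounded by the rounds reserved for the lower budgets,
  whatever the new position looks like. Otherwise the round is tight.\<close>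
lemma (in game_round) potential_decreases:
  assumes "0 < m" "budget v0 A B \<le> 2 * c + 4" "(2 * c + 2) div m \<le> q" "1 \<le> q"
  shows "potential m (q + 1) v0 (A \<union> M) (B \<union> K) < potential m (q + 1) v0 A B"
proof (cases "budget v0 (A \<union> M) (B \<union> K) = budget v0 A B")
  case True
  then interpret tight_round v0 A B M m K by unfold_locales
  show ?thesis using remaining_time_decreases[OF assms(1)] True by (simp add: potential_def)
next
  case False
  then have "budget v0 (A \<union> M) (B \<union> K) \<le> budget v0 A B - 1" "0 < budget v0 A B"
    using budget_nonincreasing by auto
  then have "potential m (q + 1) v0 (A \<union> M) (B \<union> K) + 1
      < (budget v0 A B - 1) * (budget v0 A B - 1 + 1) * (q + 1)"
    using assms by (intro potential_bound[OF _ fin' alive, of m _ c]) auto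
  also have "\<dots> = budget v0 A B * (budget v0 A B - 1) * (q + 1)"
    using \<open>0 < budget v0 A B\<close> by simp
  also have "\<dots> \<le> potential m (q + 1) v0 A B" by (simp add: potential_def)
  finally show ?thesis by simp
qed

section \<open>Breaker's strategy\<close>

definition greedy_reply :: "vertex \<Rightarrow> nat \<Rightarrow> nat \<Rightarrow> edge set \<Rightarrow> edge set \<Rightarrow> edge set" where
  "greedy_reply v0 m b A B =
    (SOME K. K \<subseteq> lattice_edges - (A \<union> B) \<and> finite K \<and> card K = b \<and> greedy v0 A B (2 * m) K)"

text \<open>The sets of edges claimed by Maker and by Breaker when Maker plays \<open>Ms\<close> and Breaker always answers
  with a greedy reply.\<close>
definition position :: "vertex \<Rightarrow> nat \<Rightarrow> nat \<Rightarrow> edge set list \<Rightarrow> edge set \<times> edge set" where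
  "position v0 m b Ms =
    foldl (\<lambda>(A, B) X. (A \<union> X, B \<union> greedy_reply v0 m b (A \<union> X) B)) ({}, {}) Ms"

definition greedy_strategy :: "vertex \<Rightarrow> nat \<Rightarrow> nat \<Rightarrow> strategy" where
  "greedy_strategy v0 m b Ms =
    greedy_reply v0 m b (\<Union>(set Ms)) (snd (position v0 m b (butlast Ms)))"

locale play =
  fixes v0 :: vertex and m b c :: nat and M :: "nat \<Rightarrow> edge set"
  assumes m_pos: "0 < m" and b_ge: "2 * m \<le> b"
begin

abbreviation R :: "nat \<Rightarrow> edge set" where
  "R \<equiv> replies (greedy_strategy v0 m b) M"

definition maker_edges :: "nat \<Rightarrow> edge set" where
  "maker_edges r = (\<Union>i<r. M i)"

definition breaker_edges :: "nat \<Rightarrow> edge set" where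
  "breaker_edges r = (\<Union>i<r. R i)"

lemma edges_Suc:
  "maker_edges (Suc r) = maker_edges r \<union> M r" "breaker_edges (Suc r) = breaker_edges r \<union> R r"
  by (auto simp: maker_edges_def breaker_edges_def less_Suc_eq)

lemma claimed_before_eq: "claimed_before M R r = maker_edges r \<union> breaker_edges r"
  by (auto simp: claimed_before_def maker_edges_def breaker_edges_def)

lemma reply_position:
  "R r = greedy_reply v0 m b (maker_edges (Suc r)) (snd (position v0 m b (map M [0..<r])))"
  by (simp add: replies_def greedy_strategy_def maker_edges_def lessThan_atLeast0 butlast_append
      atLeastLessThanSuc)

lemma position_eq: "position v0 m b (map M [0..<r]) = (maker_edges r, breaker_edges r)"
proof (induction r)
  case 0
  show ?case by (simp add: position_def maker_edges_def breaker_edges_def)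
next
  case (Suc r)
  then show ?case using reply_position[of r] by (simp add: position_def edges_Suc)
qed

lemma reply_eq: "R r = greedy_reply v0 m b (maker_edges (Suc r)) (breaker_edges r)"
  using reply_position position_eq by simp

lemma reply_properties:
  assumes "finite (maker_edges (Suc r))" "maker_edges (Suc r) \<subseteq> lattice_edges" "finite (breaker_edges r)"
  shows "R r \<subseteq> lattice_edges - (maker_edges (Suc r) \<union> breaker_edges r)" "finite (R r)" "card (R r) = b"
    "greedy v0 (maker_edges (Suc r)) (breaker_edges r) (2 * m) (R r)"
  using someI_ex[OF greedy_reply_exists[OF assms b_ge, of v0]]
  unfolding reply_eq greedy_reply_def by blast+

lemma maker_move:
  assumes "legal_maker_move m c M R r"
  shows "finite (M r)" "M r \<subseteq> lattice_edges" "M r \<inter> (maker_edges r \<union> breaker_edges r) = {}"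
    "card (M r) = (if r = 0 then m + c else m)"
  using assms unfolding legal_maker_move_def claimed_before_eq by auto

lemma position_invariant:
  assumes "\<And>i. i < r \<Longrightarrow> legal_maker_move m c M R i"
  shows "finite (maker_edges r) \<and> maker_edges r \<subseteq> lattice_edges \<and> finite (breaker_edges r) \<and>
    maker_edges r \<inter> breaker_edges r = {}"
  using assms
proof (induction r)
  case 0
  show ?case by (simp add: maker_edges_def breaker_edges_def)
next
  case (Suc r)
  then have IH: "finite (maker_edges r)" "maker_edges r \<subseteq> lattice_edges" "finite (breaker_edges r)"
    "maker_edges r \<inter> breaker_edges r = {}" and legal: "legal_maker_move m c M R r" by auto
  note move = maker_move[OF legal]
  have "finite (maker_edges (Suc r))" "maker_edges (Suc r) \<subseteq> lattice_edges"
    using IH move by (auto simp: edges_Suc)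
  note reply = reply_properties[OF this IH(3)]
  show ?case using IH move reply unfolding edges_Suc by auto
qed

lemma legal_reply:
  assumes "\<And>i. i \<le> r \<Longrightarrow> legal_maker_move m c M R i"
  shows "legal_breaker_move b M R r"
proof -
  have "finite (maker_edges (Suc r))" "maker_edges (Suc r) \<subseteq> lattice_edges"
    using position_invariant[of "Suc r"] assms by auto
  moreover have "finite (breaker_edges r)" using position_invariant[of r] assms by auto
  ultimately show ?thesis
    using reply_properties unfolding legal_breaker_move_def claimed_before_eq edges_Suc by blast
qed

end

lemma budget_start: "budget v0 {} {} = 4"
proof -
  have "component v0 {} = {v0}" by (auto simp: component_def joined_def)
  then have "heads v0 {} {} = {(y, z). y \<in> {v0} \<and> {y, z} \<in> lattice_edges}"
    using lattice_edge_neq[of v0 v0] by (auto simp: heads_def)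
  then show ?thesis using card_darts[of "{v0}"] by (simp add: budget_def stray_def)
qed

locale legal_play = play +
  assumes legal: "\<And>r. legal_maker_move m c M R r"
begin

lemma invariant:
  "finite (maker_edges r)" "maker_edges r \<subseteq> lattice_edges" "finite (breaker_edges r)"
  "maker_edges r \<inter> breaker_edges r = {}"
  using position_invariant[of r] legal by auto

lemma maker_turn: "maker_turn (maker_edges r) (breaker_edges r) (M r)"
  using invariant[of r] maker_move[OF legal, of r] by unfold_locales auto

lemma reply_greedy: "greedy v0 (maker_edges r \<union> M r) (breaker_edges r) (2 * m) (R r)"
  using reply_properties(4)[of r] invariant[of "Suc r"] invariant[of r] by (simp add: edges_Suc)

lemma game_round:
  assumes "0 < r" "heads v0 (maker_edges (Suc r)) (breaker_edges (Suc r)) \<noteq> {}"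
  shows "game_round v0 (maker_edges r) (breaker_edges r) (M r) m (R r)"
proof -
  interpret maker_turn v0 "maker_edges r" "breaker_edges r" "M r" by (rule maker_turn)
  show ?thesis
    using assms reply_greedy[of r] maker_move[OF legal, of r]
    by unfold_locales (simp_all add: edges_Suc)
qed

lemma first_round_budget:
  assumes "heads v0 (maker_edges 1) (breaker_edges 1) \<noteq> {}"
  shows "budget v0 (maker_edges 1) (breaker_edges 1) \<le> 2 * c + 4"
proof -
  interpret maker_turn v0 "maker_edges 0" "breaker_edges 0" "M 0" by (rule maker_turn)
  have "maker_edges 0 = {}" "breaker_edges 0 = {}" by (simp_all add: maker_edges_def breaker_edges_def)
  then have "budget v0 (maker_edges 0 \<union> M 0) (breaker_edges 0) \<le> 4 + 2 * (m + c)"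
    using budget_increase maker_move(4)[OF legal, of 0] budget_start by simp
  moreover have "budget v0 (maker_edges 0 \<union> M 0) (breaker_edges 0 \<union> R 0) + 2 * m
      \<le> budget v0 (maker_edges 0 \<union> M 0) (breaker_edges 0)"
    using assms reply_greedy[of 0] invariant[of 1] by (intro greedy_budget_decrease) (simp_all add: edges_Suc)
  ultimately show ?thesis by (simp add: edges_Suc)
qed

text \<open>The first round may lead to any position of budget at most \<open>2 * c + 4\<close>; from then on the potential
  decreases in every round that does not end with Breaker's win.\<close>
lemma breaker_wins_in_time:
  assumes q: "(2 * c + 2) div m \<le> q" "1 \<le> q"
  shows "\<exists>n\<le>(2 * c + 4) * (2 * c + 5) * (q + 1). breaker_has_won v0 (\<Union>r<n. R r)"
proof (rule ccontr)
  assume not_won: "\<not> ?thesis"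
  let ?N = "(2 * c + 4) * (2 * c + 5) * (q + 1)"
  have alive: "heads v0 (maker_edges n) (breaker_edges n) \<noteq> {}" if "n \<le> ?N" for n
    using not_won that no_heads_breaker_has_won[OF invariant(1,2)] unfolding breaker_edges_def by blast
  have bound: "budget v0 (maker_edges (Suc r)) (breaker_edges (Suc r)) \<le> 2 * c + 4 \<and>
      potential m (q + 1) v0 (maker_edges (Suc r)) (breaker_edges (Suc r)) + r + 1 < ?N"
    if "Suc r \<le> ?N" for r
    using that
  proof (induction r)
    case 0
    have "budget v0 (maker_edges 1) (breaker_edges 1) \<le> 2 * c + 4"
      using alive[of 1] 0 by (intro first_round_budget) simp
    moreover have "potential m (q + 1) v0 (maker_edges 1) (breaker_edges 1) + 1
        < (2 * c + 4) * (2 * c + 4 + 1) * (q + 1)"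
      using alive[of 1] 0 q m_pos invariant[of 1] calculation
      by (intro potential_bound[where c = c]) auto
    moreover have "2 * c + 4 + 1 = 2 * c + 5" by simp
    ultimately show ?case by (metis One_nat_def add_0_right)
  next
    case (Suc r)
    interpret game_round v0 "maker_edges (Suc r)" "breaker_edges (Suc r)" "M (Suc r)" m "R (Suc r)"
      using alive[OF Suc.prems] by (intro game_round) auto
    from Suc have IH: "budget v0 (maker_edges (Suc r)) (breaker_edges (Suc r)) \<le> 2 * c + 4"
      "potential m (q + 1) v0 (maker_edges (Suc r)) (breaker_edges (Suc r)) + r + 1 < ?N" by auto
    show ?case
      using budget_nonincreasing potential_decreases[OF m_pos IH(1) q] IH
      unfolding edges_Suc[of "Suc r"] by linarith
  qed
  have "Suc (?N - 1) = ?N" by simp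
  then show False using bound[of "?N - 1"] by linarith
qed

end

theorem theorem1p3:
  fixes m b c :: nat and v0 :: vertex
  assumes "m \<ge> 1" and "b \<ge> 2 * m"
  shows "breaker_wins m b c v0 \<and>
    breaker_wins_within m b c v0
      ((2 * c + 4) * (2 * c + 5) * (nat \<lceil>real (2 * c + 2) / real m\<rceil> + 1))"
proof -
  let ?s = "greedy_strategy v0 m b"
  let ?q = "nat \<lceil>real (2 * c + 2) / real m\<rceil>"
  have play: "play m b" using assms by unfold_locales auto
  have q: "(2 * c + 2) div m \<le> ?q" "1 \<le> ?q"
  proof -
    have "real ((2 * c + 2) div m) \<le> real (2 * c + 2) / real m" by (rule of_nat_div_le_of_nat)
    then show "(2 * c + 2) div m \<le> ?q" by linarith
    have "0 < real (2 * c + 2) / real m" using assms(1) by simp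
    then show "1 \<le> ?q" by linarith
  qed
  have "breaker_strategy m b c ?s"
    unfolding breaker_strategy_def using play.legal_reply[OF play] by blast
  moreover have "\<exists>n\<le>(2 * c + 4) * (2 * c + 5) * (?q + 1). breaker_has_won v0 (\<Union>r<n. replies ?s M r)"
    if "\<forall>r. legal_maker_move m c M (replies ?s M) r" for M
  proof -
    have "legal_play v0 m b c M" using play that by (simp add: legal_play_def legal_play_axioms_def)
    then show ?thesis using q by (rule legal_play.breaker_wins_in_time)
  qed
  ultimately show ?thesis unfolding breaker_wins_def breaker_wins_within_def by blast
qed

end
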